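(* Let $\mathcal{A}$ be a strongly inscribable arrangement of linear hyperplanes in $\mathbb{R}^d$ and let $L$ be a flat of $\mathcal{A}$. Then the restriction $\mathcal{A}^L=\{H\cap L : H\in\mathcal{A},\ L\not\subseteq H\}$ (an arrangement of hyperplanes in $L$) and the localization $\mathcal{A}_L=\{H\in\mathcal{A}: L\subseteq H\}$ (an arrangement in $\mathbb{R}^d$) are strongly inscribable.
   Context: An arrangement is a finite collection of distinct linear hyperplanes in a Euclidean space. The closures of the connected components of the complement of the union of the hyperplanes (the regions), together with all their faces, form a complete fan, also denoted $\mathcal{A}$. A flat of $\mathcal{A}$ is an intersection of hyperplanes of $\mathcal{A}$. The normal fan of a polytope $P$ is the collection of cones $N_FP=\{c:\langle c,x\rangle=\max_{y\in P}\langle c,y\rangle\text{ for all }x\in F\}$ for nonempty faces $F$ of $P$. A zonotope is a translate of a Minkowski sum of segments $[-z_1,z_1]+\cdots+[-z_n,z_n]$. A polytope is inscribed if its vertices lie on a common sphere. $\mathcal{A}$ is strongly inscribable if there is an inscribed zonotope whose normal fan is the fan of $\mathcal{A}$. The inner product on $L$ is the restriction of that on $\mathbb{R}^d$. *)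

theory Defs
  imports "HOL-Analysis.Analysis" "HOL-Library.Set_Algebras"
begin

text \<open>
  Arrangements, fans and polytopes are considered inside a linear subspace V of a Euclidean
  space, with the induced inner product. The choice \<^term>\<open>UNIV\<close> gives the whole space, and
  taking V to be a flat L gives arrangements in L.
\<close>

definition linear_hyperplane_in :: "'a::euclidean_space set \<Rightarrow> 'a set \<Rightarrow> bool" where
  "linear_hyperplane_in V H \<longleftrightarrow> subspace H \<and> H \<subseteq> V \<and> dim V = dim H + 1"

definition arrangement_in :: "'a::euclidean_space set \<Rightarrow> 'a set set \<Rightarrow> bool" where
  "arrangement_in V \<A> \<longleftrightarrow> subspace V \<and> finite \<A> \<and> (\<forall>H\<in>\<A>. linear_hyperplane_in V H)"

text \<open>
  In the library the empty set is a face of every convex set; it is excluded in both of the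
  following fans.
\<close>

definition arrangement_fan :: "'a::euclidean_space set \<Rightarrow> 'a set set \<Rightarrow> 'a set set" where
  "arrangement_fan V \<A> = {C. \<exists>R \<in> components (V - \<Union>\<A>). C face_of closure R \<and> C \<noteq> {}}"

definition normal_cone :: "'a::euclidean_space set \<Rightarrow> 'a set \<Rightarrow> 'a set \<Rightarrow> 'a set" where
  "normal_cone V P F = {c \<in> V. \<forall>x\<in>F. c \<bullet> x = (SUP y\<in>P. c \<bullet> y)}"

definition normal_fan :: "'a::euclidean_space set \<Rightarrow> 'a set \<Rightarrow> 'a set set" where
  "normal_fan V P = {normal_cone V P F | F. F face_of P \<and> F \<noteq> {}}"

text \<open>
  The sum is the Minkowski sum of sets; for \<open>n = 0\<close> it is \<open>{0}\<close>, so points are zonotopes.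
\<close>

definition zonotope :: "'a::euclidean_space set \<Rightarrow> bool" where
  "zonotope P \<longleftrightarrow>
     (\<exists>(n::nat) z t. P = (+) t ` (\<Sum>i<n. closed_segment (- z i) (z i)))"

text \<open>
  The vertices lie on a sphere of the Euclidean space V, hence the centre is required to be
  in V. Radius 0 is allowed, so that a single point is inscribed also when V is trivial.
\<close>

definition inscribed_in :: "'a::euclidean_space set \<Rightarrow> 'a set \<Rightarrow> bool" where
  "inscribed_in V P \<longleftrightarrow> (\<exists>c\<in>V. \<exists>r. {v. v extreme_point_of P} \<subseteq> sphere c r)"

definition strongly_inscribable :: "'a::euclidean_space set \<Rightarrow> 'a set set \<Rightarrow> bool" where
  "strongly_inscribable V \<A> \<longleftrightarrow>
     arrangement_in V \<A> \<and>
     (\<exists>P. P \<subseteq> V \<and> zonotope P \<and> inscribed_in V P \<and> normal_fan V P = arrangement_fan V \<A>)"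

text \<open>The empty intersection is V itself, which is therefore a flat.\<close>

definition flat_of :: "'a::euclidean_space set \<Rightarrow> 'a set set \<Rightarrow> 'a set \<Rightarrow> bool" where
  "flat_of V \<A> L \<longleftrightarrow> (\<exists>\<B>. \<B> \<subseteq> \<A> \<and> L = V \<inter> \<Inter>\<B>)"

definition restriction :: "'a::euclidean_space set set \<Rightarrow> 'a set \<Rightarrow> 'a set set" where
  "restriction \<A> L = {H \<inter> L | H. H \<in> \<A> \<and> \<not> L \<subseteq> H}"

definition localization :: "'a::euclidean_space set set \<Rightarrow> 'a set \<Rightarrow> 'a set set" where
  "localization \<A> L = {H \<in> \<A>. L \<subseteq> H}"

end

theory Submission imports Defs
begin

text \<open>
  Both the fan of the arrangement with normals \<open>z\<^sub>i\<close> and the normal fan of the zonotope they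
  generate consist of the cones of vectors weakly compatible with a sign vector, and the fan
  determines the arrangement; so \<open>\<A>\<close> is the arrangement of normals of an inscribed zonotope.
  The zonotope with generators \<open>z\<^sub>i\<close> is inscribed iff
  \<open>s(x) = \<Sum>\<^sub>i sgn(x \<bullet> z\<^sub>i) z\<^sub>i\<close> has constant norm for generic \<open>x\<close>.
  Let \<open>s'(x)\<close> be the part of this sum over the generators orthogonal to \<open>L\<close>. For \<open>c\<close> generic
  in \<open>L\<close>, the vector \<open>c + \<epsilon>x\<close> gives the vertex \<open>s(c) + s'(x)\<close>, and \<open>c - \<epsilon>x\<close> gives
  \<open>s(c) - s'(x)\<close>. Equality of norms makes \<open>s(c)\<close> orthogonal to every \<open>s'(x)\<close>, and Pythagoras
  makes both norms constant. The norm of \<open>s'(x)\<close> being constant settles the localization. Taking \<open>x\<close> near \<open>s(c)\<close> in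
  \<open>s(c) \<bullet> s'(x) = 0\<close> shows that \<open>s(c)\<close> is orthogonal to all these generators, hence lies in
  \<open>L\<close>; it is therefore a vertex of the orthogonal projection of the zonotope to \<open>L\<close>, which
  settles the restriction.
\<close>

section \<open>Fans of arrangements\<close>

text \<open>For \<open>x\<close> in \<open>V\<close>, the face of the fan with \<open>x\<close> in
  its relative interior: from \<open>x\<close> to \<open>c\<close>, signs may only degenerate to
  zero.\<close>

definition sign_cone :: "'a::euclidean_space set \<Rightarrow> (nat \<Rightarrow> 'a) \<Rightarrow> nat \<Rightarrow> 'a \<Rightarrow> 'a set" where
  "sign_cone V z n x = {c \<in> V. \<forall>i<n. 0 \<le> (x \<bullet> z i) * (c \<bullet> z i) \<and> (x \<bullet> z i = 0 \<longrightarrow> c \<bullet> z i = 0)}"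

text \<open>Zero generators are allowed and give no hyperplane, so a subfamily can be formed by
  zeroing entries without reindexing.\<close>

definition normals_arrangement :: "'a::euclidean_space set \<Rightarrow> (nat \<Rightarrow> 'a) \<Rightarrow> nat \<Rightarrow> 'a set set" where
  "normals_arrangement V z n = {{x \<in> V. x \<bullet> z i = 0} | i. i < n \<and> z i \<noteq> 0}"

definition generic :: "(nat \<Rightarrow> 'a::euclidean_space) \<Rightarrow> nat \<Rightarrow> 'a \<Rightarrow> bool" where
  "generic z n x \<longleftrightarrow> (\<forall>i<n. z i \<noteq> 0 \<longrightarrow> x \<bullet> z i \<noteq> 0)"

section \<open>Sign perturbation and generic points\<close>

lemma mult_nonneg_cancel_middle:
  fixes p q r :: real
  assumes "0 \<le> p * q" "0 \<le> p * r" "p \<noteq> 0"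
  shows "0 \<le> q * r"
  using assms by (auto simp: zero_le_mult_iff)

lemma mult_nonneg_if_sgn_eq:
  fixes p q :: real
  assumes "sgn p = sgn q"
  shows "0 \<le> q * p"
  using assms by (auto simp: sgn_if zero_le_mult_iff split: if_splits)

text \<open>Having a given nonzero sign is an open condition, and finitely many such conditions hold
  together for small \<open>e\<close>.\<close>

lemma perturb_signs:
  fixes x y :: "'a::euclidean_space"
  shows "\<exists>e>0. \<forall>i<n::nat. x \<bullet> z i \<noteq> 0 \<longrightarrow> sgn ((x + e *\<^sub>R y) \<bullet> z i) = sgn (x \<bullet> z i)"
proof -
  have "\<forall>\<^sub>F e in at_right (0::real). \<forall>i\<in>{..<n}. x \<bullet> z i \<noteq> 0 \<longrightarrow> sgn ((x + e *\<^sub>R y) \<bullet> z i) = sgn (x \<bullet> z i)"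
  proof (rule eventually_ball_finite, simp, rule ballI)
    fix i
    have lim: "((\<lambda>e. (x + e *\<^sub>R y) \<bullet> z i) \<longlongrightarrow> (x + 0 *\<^sub>R y) \<bullet> z i) (at_right 0)"
      by (intro tendsto_intros)
    consider "x \<bullet> z i = 0" | "x \<bullet> z i > 0" | "x \<bullet> z i < 0" by linarith
    then show "\<forall>\<^sub>F e in at_right 0. x \<bullet> z i \<noteq> 0 \<longrightarrow> sgn ((x + e *\<^sub>R y) \<bullet> z i) = sgn (x \<bullet> z i)"
    proof cases
      case 2
      then have "\<forall>\<^sub>F e in at_right 0. (x + e *\<^sub>R y) \<bullet> z i > 0"
        using lim by (intro order_tendstoD) auto
      then show ?thesis by eventually_elim (use 2 in simp)
    next
      case 3
      then have "\<forall>\<^sub>F e in at_right 0. (x + e *\<^sub>R y) \<bullet> z i < 0"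
        using lim by (intro order_tendstoD) auto
      then show ?thesis by eventually_elim (use 3 in simp)
    qed simp
  qed
  then have "\<forall>\<^sub>F e in at_right (0::real). 0 < e \<and> (\<forall>i<n. x \<bullet> z i \<noteq> 0 \<longrightarrow> sgn ((x + e *\<^sub>R y) \<bullet> z i) = sgn (x \<bullet> z i))"
    using eventually_at_right_less[of "0::real"] by eventually_elim auto
  then show ?thesis
    using eventually_happens' trivial_limit_at_right_real by blast
qed

text \<open>Induction over the functionals: a point that fails only the new one is moved slightly in
  a direction where that functional is nonzero. The normals may lie outside \<open>V\<close>; those
  orthogonal to \<open>V\<close> are exempt.\<close>

lemma exists_avoiding_hyperplanes:
  fixes z :: "nat \<Rightarrow> 'a::euclidean_space"
  assumes "subspace V"
  shows "\<exists>x\<in>V. \<forall>i<n. (\<exists>y\<in>V. y \<bullet> z i \<noteq> 0) \<longrightarrow> x \<bullet> z i \<noteq> 0"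
proof (induction n)
  case 0
  then show ?case using assms subspace_0 by blast
next
  case (Suc n)
  then obtain x where x: "x \<in> V" "\<And>i. i < n \<Longrightarrow> (\<exists>y\<in>V. y \<bullet> z i \<noteq> 0) \<Longrightarrow> x \<bullet> z i \<noteq> 0"
    by blast
  show ?case
  proof (cases "(\<exists>y\<in>V. y \<bullet> z n \<noteq> 0) \<and> x \<bullet> z n = 0")
    case True
    then obtain y where y: "y \<in> V" "y \<bullet> z n \<noteq> 0" by blast
    obtain e where e: "e > 0" "\<forall>i<n. x \<bullet> z i \<noteq> 0 \<longrightarrow> sgn ((x + e *\<^sub>R y) \<bullet> z i) = sgn (x \<bullet> z i)"
      using perturb_signs by blast
    have "(x + e *\<^sub>R y) \<bullet> z i \<noteq> 0" if "i < Suc n" "\<exists>y\<in>V. y \<bullet> z i \<noteq> 0" for i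
    proof (cases "i = n")
      case True
      then show ?thesis using y e \<open>_ \<and> x \<bullet> z n = 0\<close> by (simp add: inner_add_left)
    next
      case False
      then show ?thesis using that x e by (metis less_antisym sgn_zero_iff)
    qed
    moreover have "x + e *\<^sub>R y \<in> V"
      using assms x y by (simp add: subspace_add subspace_mul)
    ultimately show ?thesis by blast
  next
    case False
    then show ?thesis using x by (metis less_antisym)
  qed
qed

lemma exists_generic:
  assumes "subspace V" "\<forall>i<n. z i \<in> V"
  shows "\<exists>x\<in>V. generic z n x"
proof -
  obtain x where "x \<in> V" "\<forall>i<n. (\<exists>y\<in>V. y \<bullet> z i \<noteq> 0) \<longrightarrow> x \<bullet> z i \<noteq> 0"
    using exists_avoiding_hyperplanes[OF assms(1)] by blast
  then have "generic z n x"
    using assms(2) unfolding generic_def by (metis inner_eq_zero_iff)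
  with \<open>x \<in> V\<close> show ?thesis by blast
qed

text \<open>A small step along a generic vector resolves the zero signs of \<open>x\<close> and
  keeps the others.\<close>

lemma exists_generic_refinement:
  assumes "subspace V" "\<forall>i<n. z i \<in> V" "x \<in> V"
  shows "\<exists>y\<in>V. generic z n y \<and> (\<forall>i<n. x \<bullet> z i \<noteq> 0 \<longrightarrow> sgn (y \<bullet> z i) = sgn (x \<bullet> z i))"
proof -
  obtain g where g: "g \<in> V" "generic z n g"
    using exists_generic assms by blast
  obtain e where e: "e > 0" "\<forall>i<n. x \<bullet> z i \<noteq> 0 \<longrightarrow> sgn ((x + e *\<^sub>R g) \<bullet> z i) = sgn (x \<bullet> z i)"
    using perturb_signs by blast
  have "generic z n (x + e *\<^sub>R g)"
    unfolding generic_def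
  proof (intro allI impI)
    fix i assume i: "i < n" "z i \<noteq> 0"
    show "(x + e *\<^sub>R g) \<bullet> z i \<noteq> 0"
    proof (cases "x \<bullet> z i = 0")
      case True
      then show ?thesis using g e i by (simp add: generic_def inner_add_left)
    next
      case False
      then show ?thesis using e i by (metis sgn_zero_iff)
    qed
  qed
  moreover have "x + e *\<^sub>R g \<in> V"
    using assms g by (simp add: subspace_add subspace_mul)
  ultimately show ?thesis using e by blast
qed

section \<open>Chambers and their closures\<close>

lemma convex_sign_cone: "subspace V \<Longrightarrow> convex (sign_cone V z n x)"
proof -
  assume V: "subspace V"
  have "sign_cone V z n x = V \<inter> (\<Inter>i\<in>{..<n}. {c. ((x \<bullet> z i) *\<^sub>R z i) \<bullet> c \<ge> 0} \<inter>
      (if x \<bullet> z i = 0 then {c. z i \<bullet> c = 0} else UNIV))"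
    by (auto simp: sign_cone_def inner_commute split: if_splits)
  also have "convex \<dots>"
    by (intro convex_Int subspace_imp_convex[OF V] convex_INT)
       (auto intro!: convex_Int convex_halfspace_ge convex_hyperplane simp del: inner_scaleR_left)
  finally show ?thesis .
qed

lemma convex_sgn_inner_eq:
  fixes a :: "'a::real_inner"
  shows "convex {c. sgn (c \<bullet> a) = sgn (r::real)}"
proof -
  consider "r = 0" | "r > 0" | "r < 0" by linarith
  then show ?thesis
  proof cases
    case 1
    then show ?thesis using convex_hyperplane[of a 0] by (simp add: inner_commute sgn_zero_iff)
  next
    case 2
    then show ?thesis using convex_halfspace_gt[of 0 a] by (simp add: inner_commute sgn_1_pos)
  next
    case 3
    then show ?thesis using convex_halfspace_lt[of a 0] by (simp add: inner_commute sgn_1_neg)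
  qed
qed

text \<open>The sign region is convex, hence connected; a connected set joining \<open>x\<close> to
  a point with another sign would meet a hyperplane by the intermediate value theorem.\<close>

lemma component_eq_sign_region:
  assumes V: "subspace V" and z: "\<forall>i<n. z i \<in> V" and x: "x \<in> V" "generic z n x"
  shows "connected_component_set (V - \<Union>(normals_arrangement V z n)) x
       = {c \<in> V. \<forall>i<n. sgn (c \<bullet> z i) = sgn (x \<bullet> z i)}" (is "_ = ?R")
proof (rule connected_component_unique)
  show "x \<in> ?R" using x by simp
  show "?R \<subseteq> V - \<Union>(normals_arrangement V z n)"
    using x unfolding normals_arrangement_def generic_def by (auto, metis sgn_zero_iff)
  have "?R = V \<inter> (\<Inter>i\<in>{..<n}. {c. sgn (c \<bullet> z i) = sgn (x \<bullet> z i)})"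
    by auto
  moreover have "convex \<dots>"
    by (intro convex_Int subspace_imp_convex[OF V] convex_INT convex_sgn_inner_eq)
  ultimately show "connected ?R" by (simp add: convex_connected)
  fix C assume C: "x \<in> C" "C \<subseteq> V - \<Union>(normals_arrangement V z n)" "connected C"
  show "C \<subseteq> ?R"
  proof
    fix c assume c: "c \<in> C"
    have "sgn (c \<bullet> z i) = sgn (x \<bullet> z i)" if i: "i < n" for i
    proof (rule ccontr)
      assume ne: "sgn (c \<bullet> z i) \<noteq> sgn (x \<bullet> z i)"
      then have "z i \<noteq> 0" by auto
      have "(z i \<bullet> c \<le> 0 \<and> 0 \<le> z i \<bullet> x) \<or> (z i \<bullet> x \<le> 0 \<and> 0 \<le> z i \<bullet> c)"
        using ne by (auto simp: sgn_if inner_commute split: if_splits)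
      then obtain w where "w \<in> C" "z i \<bullet> w = 0"
        using connected_ivt_hyperplane[OF C(3)] C(1) c by metis
      then show False
        using C(2) i \<open>z i \<noteq> 0\<close> unfolding normals_arrangement_def by (auto simp: inner_commute)
    qed
    then show "c \<in> ?R" using C c by auto
  qed
qed

text \<open>The weak inequalities define a closed set. Conversely, \<open>c\<close> is the limit of
  \<open>c + e x\<close> as \<open>e\<close> decreases to 0, and these points have the signs of
  \<open>x\<close>.\<close>

lemma closure_sign_region:
  assumes V: "subspace V" and x: "x \<in> V" "generic z n x"
  shows "closure {c \<in> V. \<forall>i<n. sgn (c \<bullet> z i) = sgn (x \<bullet> z i)}
       = {c \<in> V. \<forall>i<n. 0 \<le> (x \<bullet> z i) * (c \<bullet> z i)}" (is "closure ?R = ?K")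
proof
  have "?K = V \<inter> (\<Inter>i\<in>{..<n}. {c. ((x \<bullet> z i) *\<^sub>R z i) \<bullet> c \<ge> 0})"
    by (auto simp: inner_commute)
  moreover have "closed \<dots>"
    by (intro closed_Int closed_subspace V closed_INT ballI closed_halfspace_ge)
  ultimately have "closed ?K" by simp
  moreover have "?R \<subseteq> ?K"
    using mult_nonneg_if_sgn_eq by blast
  ultimately show "closure ?R \<subseteq> ?K" by (rule closure_minimal[rotated])
  show "?K \<subseteq> closure ?R"
  proof
    fix c assume c: "c \<in> ?K"
    have inR: "c + e *\<^sub>R x \<in> ?R" if e: "e > 0" for e
    proof -
      have "sgn ((c + e *\<^sub>R x) \<bullet> z i) = sgn (x \<bullet> z i)" if i: "i < n" for i
      proof -
        have *: "0 \<le> (x \<bullet> z i) * (c \<bullet> z i)" using c i by auto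
        consider "z i = 0" | "x \<bullet> z i > 0" | "x \<bullet> z i < 0"
          using x i unfolding generic_def by (metis linorder_neqE_linordered_idom)
        then show ?thesis
        proof cases
          case 2
          then have "0 \<le> c \<bullet> z i" using * by (simp add: zero_le_mult_iff)
          then have "(c + e *\<^sub>R x) \<bullet> z i > 0" using 2 e by (simp add: inner_add_left add_nonneg_pos)
          then show ?thesis using 2 by simp
        next
          case 3
          then have "c \<bullet> z i \<le> 0" using * by (simp add: zero_le_mult_iff)
          then have "(c + e *\<^sub>R x) \<bullet> z i < 0" using 3 e
            by (simp add: inner_add_left add_nonpos_neg mult_pos_neg)
          then show ?thesis using 3 by simp
        qed simp
      qed
      moreover have "c + e *\<^sub>R x \<in> V"
        using V x c by (simp add: subspace_add subspace_mul)
      ultimately show ?thesis by blast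
    qed
    have "((\<lambda>e. c + e *\<^sub>R x) \<longlongrightarrow> c + 0 *\<^sub>R x) (at_right (0::real))"
      by (intro tendsto_intros)
    moreover have "\<forall>\<^sub>F e in at_right (0::real). c + e *\<^sub>R x \<in> closure ?R"
      using eventually_at_right_less[of "0::real"]
      by eventually_elim (rule subsetD[OF closure_subset inR])
    ultimately have "c + 0 *\<^sub>R x \<in> closure ?R"
      by (intro Lim_in_closed_set[OF closed_closure _ trivial_limit_at_right_real])
    then show "c \<in> closure ?R" by simp
  qed
qed

section \<open>Faces of chambers as sign cones\<close>

lemma face_of_chamber_imp_sign_cone:
  assumes V: "subspace V" and x: "x \<in> V" "generic z n x"
    and F: "F face_of {c \<in> V. \<forall>i<n. 0 \<le> (x \<bullet> z i) * (c \<bullet> z i)}" (is "F face_of ?K") and "F \<noteq> {}"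
  shows "\<exists>y\<in>V. F = sign_cone V z n y"
proof -
  \<comment> \<open>The signs are read off at a relative interior point of the face.\<close>
  have "convex F" "F \<subseteq> ?K" using F by (rule face_of_imp_convex, rule face_of_imp_subset)
  then obtain y where y: "y \<in> rel_interior F" using \<open>F \<noteq> {}\<close> rel_interior_eq_empty by blast
  then have "y \<in> F" using rel_interior_subset by blast
  with \<open>F \<subseteq> ?K\<close> have yV: "y \<in> V" and yK: "\<And>i. i < n \<Longrightarrow> 0 \<le> (x \<bullet> z i) * (y \<bullet> z i)" by auto
  have "c \<in> sign_cone V z n y" if c: "c \<in> F" for c
  proof -
    from c \<open>F \<subseteq> ?K\<close> have cV: "c \<in> V" and cK: "\<And>i. i < n \<Longrightarrow> 0 \<le> (x \<bullet> z i) * (c \<bullet> z i)" by auto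
    have "0 \<le> (y \<bullet> z i) * (c \<bullet> z i)" if "i < n" for i
      using mult_nonneg_cancel_middle[OF yK cK] that x unfolding generic_def
      by (metis inner_zero_right mult_zero_right order_refl)
    moreover have "c \<bullet> z i = 0" if i: "i < n" "y \<bullet> z i = 0" for i
    proof (cases "z i = 0")
      case False
      \<comment> \<open>The segment from \<open>c\<close> to \<open>y\<close> extends beyond
        \<open>y\<close> inside \<open>F\<close>. There \<open>c\<close> has the negative
        coefficient \<open>1 - e\<close>, so a nonzero \<open>c \<bullet> z i\<close> would violate
        the chamber inequality.\<close>
      obtain e where e: "e > 1" "(1 - e) *\<^sub>R c + e *\<^sub>R y \<in> F"
        using convex_rel_interior_if2[OF \<open>convex F\<close> y] c hull_inc by metis
      then have "0 \<le> (x \<bullet> z i) * (((1 - e) *\<^sub>R c + e *\<^sub>R y) \<bullet> z i)"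
        using \<open>F \<subseteq> ?K\<close> i by auto
      then have "0 \<le> (1 - e) * ((x \<bullet> z i) * (c \<bullet> z i))"
        using i by (simp add: inner_add_left mult.left_commute)
      then have "(x \<bullet> z i) * (c \<bullet> z i) \<le> 0"
        using e by (simp add: zero_le_mult_iff)
      then show ?thesis using cK[OF i(1)] x False i unfolding generic_def
        by (metis mult_eq_0_iff order_antisym)
    qed simp
    ultimately show ?thesis using cV unfolding sign_cone_def by blast
  qed
  moreover have "c \<in> F" if c: "c \<in> sign_cone V z n y" for c
  proof (cases "c = y")
    case False
    have cV: "c \<in> V" using c unfolding sign_cone_def by auto
    obtain e where e: "e > 0"
      "\<forall>i<n. y \<bullet> z i \<noteq> 0 \<longrightarrow> sgn ((y + e *\<^sub>R (y - c)) \<bullet> z i) = sgn (y \<bullet> z i)"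
      using perturb_signs by blast
    \<comment> \<open>A point slightly beyond \<open>y\<close> on the ray from \<open>c\<close>. It
      stays in the chamber, and since \<open>y\<close> lies strictly between \<open>c\<close> and
      \<open>b\<close>, the face property puts \<open>c\<close> into \<open>F\<close>.\<close>
    define b where "b = y + e *\<^sub>R (y - c)"
    have "0 \<le> (x \<bullet> z i) * (b \<bullet> z i) \<and> 0 \<le> (x \<bullet> z i) * (c \<bullet> z i)" if i: "i < n" for i
    proof (cases "y \<bullet> z i = 0")
      case True
      then show ?thesis using c i
        by (simp add: sign_cone_def b_def inner_add_left inner_diff_left)
    next
      case False
      have "sgn (b \<bullet> z i) = sgn (y \<bullet> z i)" using e i False b_def by simp
      then have "0 \<le> (y \<bullet> z i) * (b \<bullet> z i)"
        by (rule mult_nonneg_if_sgn_eq)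
      moreover have "0 \<le> (y \<bullet> z i) * (c \<bullet> z i)" using c i by (simp add: sign_cone_def)
      moreover have "0 \<le> (y \<bullet> z i) * (x \<bullet> z i)" using yK[OF i] by (simp add: mult.commute)
      ultimately show ?thesis using False mult_nonneg_cancel_middle by blast
    qed
    moreover have "b \<in> V" unfolding b_def
      using V yV cV by (simp add: subspace_add subspace_mul subspace_diff)
    ultimately have "b \<in> ?K" "c \<in> ?K" using cV by auto
    moreover have "y \<in> open_segment c b"
    proof -
      have "y = (1 - 1 / (1 + e)) *\<^sub>R c + (1 / (1 + e)) *\<^sub>R b"
      proof -
        have "(1 + e) *\<^sub>R y = e *\<^sub>R c + b" unfolding b_def by (simp add: algebra_simps)
        then have "(1 / (1 + e)) *\<^sub>R ((1 + e) *\<^sub>R y) = (1 / (1 + e)) *\<^sub>R (e *\<^sub>R c + b)" by simp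
        moreover have "1 - 1 / (1 + e) = e / (1 + e)" using e by (simp add: field_simps)
        ultimately show ?thesis using e by (simp add: scaleR_add_right)
      qed
      moreover have "c \<noteq> b"
      proof
        assume "c = b"
        then have "(1 + e) *\<^sub>R (y - c) = 0" unfolding b_def by (simp add: algebra_simps)
        then show False using e False by simp
      qed
      moreover have "0 < 1 / (1 + e)" "1 / (1 + e) < 1" using e by auto
      ultimately show ?thesis unfolding in_segment by blast
    qed
    ultimately show ?thesis using face_ofD[OF F] \<open>y \<in> F\<close> by blast
  qed (use \<open>y \<in> F\<close> in simp)
  ultimately show ?thesis using yV by blast
qed

text \<open>Within the chamber the cone is cut out by the equations
  \<open>c \<bullet> z i = 0\<close> for the zero signs of \<open>y\<close>. If they hold inside a
  segment, two nonnegative endpoint terms sum to zero, so they hold at both ends.\<close>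

lemma sign_cone_face_of_chamber:
  assumes V: "subspace V" and x: "generic z n x"
    and y: "y \<in> V" "\<forall>i<n. 0 \<le> (x \<bullet> z i) * (y \<bullet> z i)"
  shows "sign_cone V z n y face_of {c \<in> V. \<forall>i<n. 0 \<le> (x \<bullet> z i) * (c \<bullet> z i)}" (is "_ face_of ?K")
  unfolding face_of_def
proof (intro conjI ballI impI convex_sign_cone V)
  show "sign_cone V z n y \<subseteq> ?K"
  proof
    fix c assume c: "c \<in> sign_cone V z n y"
    have "0 \<le> (x \<bullet> z i) * (c \<bullet> z i)" if i: "i < n" for i
      using mult_nonneg_cancel_middle[of "y \<bullet> z i" "x \<bullet> z i" "c \<bullet> z i"] c y i
      unfolding sign_cone_def by (cases "y \<bullet> z i = 0") (auto simp: mult.commute)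
    then show "c \<in> ?K" using c by (auto simp: sign_cone_def)
  qed
  have both: "a \<in> sign_cone V z n y"
    if ab: "a \<in> ?K" "b \<in> ?K" and c: "c \<in> sign_cone V z n y" "c \<in> open_segment a b" for a b c
  proof -
    obtain u where u: "0 < u" "u < 1" "c = (1 - u) *\<^sub>R a + u *\<^sub>R b"
      using c(2) by (auto simp: in_segment)
    have zero: "a \<bullet> z i = 0" if i: "i < n" "y \<bullet> z i = 0" for i
    proof (cases "z i = 0")
      case False
      have "c \<bullet> z i = 0" using c i by (simp add: sign_cone_def)
      then have "(x \<bullet> z i) * (((1 - u) *\<^sub>R a + u *\<^sub>R b) \<bullet> z i) = 0" using u by simp
      then have "(1 - u) * ((x \<bullet> z i) * (a \<bullet> z i)) + u * ((x \<bullet> z i) * (b \<bullet> z i)) = 0"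
        by (simp add: algebra_simps)
      moreover have "0 \<le> (x \<bullet> z i) * (a \<bullet> z i)" "0 \<le> (x \<bullet> z i) * (b \<bullet> z i)"
        using ab i by auto
      ultimately have "(1 - u) * ((x \<bullet> z i) * (a \<bullet> z i)) = 0"
        using u by (smt (verit) mult_nonneg_nonneg)
      then show ?thesis using u x False i unfolding generic_def by auto
    qed simp
    have "0 \<le> (y \<bullet> z i) * (a \<bullet> z i)" if i: "i < n" for i
      using mult_nonneg_cancel_middle[of "x \<bullet> z i" "y \<bullet> z i" "a \<bullet> z i"] ab y i x
      unfolding generic_def by (cases "z i = 0") auto
    then show ?thesis using zero ab unfolding sign_cone_def by auto
  qed
  fix a b c assume "a \<in> ?K" "b \<in> ?K" "c \<in> sign_cone V z n y" "c \<in> open_segment a b"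
  then show "a \<in> sign_cone V z n y" "b \<in> sign_cone V z n y"
    using both[of a b c] both[of b a c] by (auto simp: open_segment_commute)
qed

text \<open>The cone of \<open>y\<close> is found as a face of the closed chamber of a generic
  refinement of \<open>y\<close>.\<close>

lemma arrangement_fan_eq_sign_cones:
  assumes V: "subspace V" and z: "\<forall>i<n. z i \<in> V"
  shows "arrangement_fan V (normals_arrangement V z n) = sign_cone V z n ` V"
proof
  let ?S = "V - \<Union>(normals_arrangement V z n)"
  have in_complement: "x \<in> ?S \<longleftrightarrow> x \<in> V \<and> generic z n x" for x
    unfolding normals_arrangement_def generic_def by auto
  have closure_component: "closure (connected_component_set ?S x)
      = {c \<in> V. \<forall>i<n. 0 \<le> (x \<bullet> z i) * (c \<bullet> z i)}" if "x \<in> V" "generic z n x" for x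
    using component_eq_sign_region[OF V z that] closure_sign_region[OF V that] by simp
  show "arrangement_fan V (normals_arrangement V z n) \<subseteq> sign_cone V z n ` V"
  proof
    fix C assume "C \<in> arrangement_fan V (normals_arrangement V z n)"
    then obtain x where "x \<in> ?S" "C face_of closure (connected_component_set ?S x)" "C \<noteq> {}"
      unfolding arrangement_fan_def components_def by blast
    then show "C \<in> sign_cone V z n ` V"
      using in_complement closure_component face_of_chamber_imp_sign_cone[OF V, of x z n C] by auto
  qed
  show "sign_cone V z n ` V \<subseteq> arrangement_fan V (normals_arrangement V z n)"
  proof
    fix C assume "C \<in> sign_cone V z n ` V"
    then obtain y where y: "y \<in> V" "C = sign_cone V z n y" by blast
    obtain x where x: "x \<in> V" "generic z n x"
      "\<forall>i<n. y \<bullet> z i \<noteq> 0 \<longrightarrow> sgn (x \<bullet> z i) = sgn (y \<bullet> z i)"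
      using exists_generic_refinement[OF V z y(1)] by blast
    have "0 \<le> (x \<bullet> z i) * (y \<bullet> z i)" if "i < n" for i
      using x(3) that mult_nonneg_if_sgn_eq[of "y \<bullet> z i" "x \<bullet> z i"] by (cases "y \<bullet> z i = 0") auto
    then have "C face_of closure (connected_component_set ?S x)"
      using closure_component[OF x(1,2)] sign_cone_face_of_chamber[OF V x(2) y(1)] y(2) by simp
    moreover have "connected_component_set ?S x \<in> components ?S"
      using in_complement x componentsI by blast
    moreover have "y \<in> C" using y by (simp add: sign_cone_def)
    ultimately show "C \<in> arrangement_fan V (normals_arrangement V z n)"
      unfolding arrangement_fan_def by blast
  qed
qed

section \<open>Zonotopes\<close>

definition generated_zonotope :: "'a::euclidean_space \<Rightarrow> (nat \<Rightarrow> 'a) \<Rightarrow> nat \<Rightarrow> 'a set" where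
  "generated_zonotope t z n = (+) t ` (\<Sum>i<n. closed_segment (- z i) (z i))"

text \<open>For generic \<open>x\<close>, the vertex of the centred zonotope that maximizes
  \<open>x\<close>; in general, since \<open>sgn 0 = 0\<close>, the centre of the maximizing
  face.\<close>

definition sign_sum :: "(nat \<Rightarrow> 'a::euclidean_space) \<Rightarrow> nat \<Rightarrow> 'a \<Rightarrow> 'a" where
  "sign_sum z n x = (\<Sum>i<n. sgn (x \<bullet> z i) *\<^sub>R z i)"

lemma sign_sum_minus: "sign_sum z n (- x) = - sign_sum z n x"
  by (simp add: sign_sum_def sum_negf sgn_minus)

lemma sign_sum_in_subspace: "subspace V \<Longrightarrow> \<forall>i<n. z i \<in> V \<Longrightarrow> sign_sum z n x \<in> V"
  unfolding sign_sum_def by (auto intro!: subspace_sum subspace_mul)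

lemma generic_minus: "generic z n (- x) \<longleftrightarrow> generic z n x"
  by (simp add: generic_def)

lemma closed_segment_minus_eq:
  fixes a :: "'a::real_vector"
  shows "closed_segment (- a) a = {l *\<^sub>R a | l. \<bar>l\<bar> \<le> 1}"
proof
  show "closed_segment (- a) a \<subseteq> {l *\<^sub>R a | l. \<bar>l\<bar> \<le> 1}"
  proof
    fix x assume "x \<in> closed_segment (- a) a"
    then obtain u where u: "0 \<le> u" "u \<le> 1" "x = (1 - u) *\<^sub>R (- a) + u *\<^sub>R a"
      by (auto simp: in_segment)
    then have "x = (2 * u - 1) *\<^sub>R a" by (simp add: algebra_simps flip: scaleR_2)
    moreover have "\<bar>2 * u - 1\<bar> \<le> 1" using u by simp
    ultimately show "x \<in> {l *\<^sub>R a | l. \<bar>l\<bar> \<le> 1}" by blast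
  qed
  show "{l *\<^sub>R a | l. \<bar>l\<bar> \<le> 1} \<subseteq> closed_segment (- a) a"
  proof
    fix x assume "x \<in> {l *\<^sub>R a | l. \<bar>l\<bar> \<le> 1}"
    then obtain l where l: "\<bar>l\<bar> \<le> 1" "x = l *\<^sub>R a" by blast
    have "x = (1 - (1 + l) / 2) *\<^sub>R (- a) + ((1 + l) / 2) *\<^sub>R a"
    proof -
      have "(1 - (1 + l) / 2) *\<^sub>R (- a) + ((1 + l) / 2) *\<^sub>R a = ((1 + l) / 2 - (1 - (1 + l) / 2)) *\<^sub>R a"
        unfolding scaleR_diff_left[of "(1 + l) / 2"] by simp
      also have "(1 + l) / 2 - (1 - (1 + l) / 2) = l" by (simp add: field_simps)
      finally show ?thesis using l by simp
    qed
    moreover have "0 \<le> (1 + l) / 2" "(1 + l) / 2 \<le> 1" using l by auto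
    ultimately show "x \<in> closed_segment (- a) a" unfolding in_segment by blast
  qed
qed

lemma mem_generated_zonotope:
  "p \<in> generated_zonotope t z n \<longleftrightarrow> (\<exists>l. (\<forall>i<n. \<bar>l i\<bar> \<le> 1) \<and> p = t + (\<Sum>i<n. l i *\<^sub>R z i))"
proof
  assume "p \<in> generated_zonotope t z n"
  then obtain s where s: "\<forall>i<n. s i \<in> closed_segment (- z i) (z i)" "p = t + sum s {..<n}"
    by (auto simp: generated_zonotope_def set_sum_alt)
  then have "\<forall>i. \<exists>l. i < n \<longrightarrow> \<bar>l\<bar> \<le> 1 \<and> s i = l *\<^sub>R z i"
    by (auto simp: closed_segment_minus_eq)
  then obtain l where "\<forall>i. i < n \<longrightarrow> \<bar>l i\<bar> \<le> 1 \<and> s i = l i *\<^sub>R z i" by metis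
  then show "\<exists>l. (\<forall>i<n. \<bar>l i\<bar> \<le> 1) \<and> p = t + (\<Sum>i<n. l i *\<^sub>R z i)"
    using s by (intro exI[of _ l]) simp
next
  assume "\<exists>l. (\<forall>i<n. \<bar>l i\<bar> \<le> 1) \<and> p = t + (\<Sum>i<n. l i *\<^sub>R z i)"
  then obtain l where "\<forall>i<n. \<bar>l i\<bar> \<le> 1" "p = t + (\<Sum>i<n. l i *\<^sub>R z i)" by blast
  moreover from this have "(\<Sum>i<n. l i *\<^sub>R z i) \<in> (\<Sum>i<n. closed_segment (- z i) (z i))"
    unfolding set_sum_alt[OF finite_lessThan] closed_segment_minus_eq
    by (intro CollectI exI[of _ "\<lambda>i. l i *\<^sub>R z i"]) auto
  ultimately show "p \<in> generated_zonotope t z n" by (simp add: generated_zonotope_def)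
qed

text \<open>Convex hulls commute with translations and Minkowski sums, so the zonotope is the hull
  of a finite set of signed sums. Its faces are therefore exposed.\<close>

lemma polytope_generated_zonotope: "polytope (generated_zonotope t z n)"
proof -
  have "finite (\<Sum>i<n. {- z i, z i})"
    by (induction n) (auto intro: finite_set_plus)
  moreover have "generated_zonotope t z n = convex hull ((+) t ` (\<Sum>i<n. {- z i, z i}))"
    by (simp add: generated_zonotope_def segment_convex_hull convex_hull_translation
        convex_hull_set_sum)
  ultimately show ?thesis by (simp add: polytope_convex_hull)
qed

lemma generated_zonotope_subset:
  assumes "subspace V" "t \<in> V" "\<forall>i<n. z i \<in> V"
  shows "generated_zonotope t z n \<subseteq> V"
  using assms by (auto simp: mem_generated_zonotope intro!: subspace_add subspace_sum subspace_mul)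

section \<open>The support function of a zonotope in closed form, and the faces it exposes\<close>

definition support :: "'a::euclidean_space \<Rightarrow> (nat \<Rightarrow> 'a) \<Rightarrow> nat \<Rightarrow> 'a \<Rightarrow> real" where
  "support t z n x = x \<bullet> t + (\<Sum>i<n. \<bar>x \<bullet> z i\<bar>)"

definition support_face :: "'a::euclidean_space \<Rightarrow> (nat \<Rightarrow> 'a) \<Rightarrow> nat \<Rightarrow> 'a \<Rightarrow> 'a set" where
  "support_face t z n x = {p \<in> generated_zonotope t z n. x \<bullet> p = support t z n x}"

lemma sgn_mult_self_eq_abs: "sgn r * r = \<bar>r\<bar>" for r :: real
  by (metis abs_sgn mult.commute)

lemma abs_sgn_le_1: "\<bar>sgn r\<bar> \<le> 1" for r :: real
  by (simp add: abs_sgn_eq)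

lemma mult_le_abs_if_abs_le_1: "\<bar>l\<bar> \<le> 1 \<Longrightarrow> l * r \<le> \<bar>r\<bar>" for l r :: real
  by (metis abs_ge_self abs_ge_zero abs_mult mult_left_le_one_le order_trans)

lemma inner_le_support: "p \<in> generated_zonotope t z n \<Longrightarrow> x \<bullet> p \<le> support t z n x"
  by (auto simp: mem_generated_zonotope support_def inner_add_right inner_sum_right
      intro!: sum_mono mult_le_abs_if_abs_le_1)

text \<open>The gap to the maximum is a sum of nonnegative terms, one for each generator.\<close>

lemma inner_eq_support_iff:
  assumes "\<forall>i<n. \<bar>l i\<bar> \<le> 1"
  shows "x \<bullet> (t + (\<Sum>i<n. l i *\<^sub>R z i)) = support t z n x
    \<longleftrightarrow> (\<forall>i<n. l i * (x \<bullet> z i) = \<bar>x \<bullet> z i\<bar>)"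
proof -
  have "x \<bullet> (t + (\<Sum>i<n. l i *\<^sub>R z i)) = support t z n x
      \<longleftrightarrow> (\<Sum>i<n. \<bar>x \<bullet> z i\<bar> - l i * (x \<bullet> z i)) = 0"
    by (auto simp: support_def inner_add_right inner_sum_right sum_subtractf)
  also have "\<dots> \<longleftrightarrow> (\<forall>i\<in>{..<n}. \<bar>x \<bullet> z i\<bar> - l i * (x \<bullet> z i) = 0)"
    using assms by (intro sum_nonneg_eq_0_iff) (auto intro: mult_le_abs_if_abs_le_1)
  finally show ?thesis by auto
qed

lemma mem_support_face:
  "p \<in> support_face t z n x \<longleftrightarrow> (\<exists>l. (\<forall>i<n. \<bar>l i\<bar> \<le> 1 \<and> l i * (x \<bullet> z i) = \<bar>x \<bullet> z i\<bar>)
     \<and> p = t + (\<Sum>i<n. l i *\<^sub>R z i))"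
  unfolding support_face_def mem_Collect_eq mem_generated_zonotope
  using inner_eq_support_iff by blast

lemma sign_sum_in_support_face: "t + sign_sum z n x \<in> support_face t z n x"
  unfolding mem_support_face sign_sum_def
  by (intro exI[of _ "\<lambda>i. sgn (x \<bullet> z i)"]) (simp add: sgn_mult_self_eq_abs abs_sgn_le_1)

lemma support_face_face_of: "support_face t z n x face_of generated_zonotope t z n"
proof -
  have "support_face t z n x = generated_zonotope t z n \<inter> {p. x \<bullet> p = support t z n x}"
    by (auto simp: support_face_def)
  then show ?thesis
    by (simp add: face_of_Int_supporting_hyperplane_le inner_le_support polytope_imp_convex
        polytope_generated_zonotope)
qed

text \<open>Faces of a polyhedron are exposed. The exposing normal \<open>a\<close> may lie outside
  \<open>V\<close>, but its projection \<open>x\<close> to \<open>V\<close> has the same inner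
  products with the zonotope.\<close>

lemma face_of_generated_zonotope:
  assumes V: "subspace V" and "t \<in> V" "\<forall>i<n. z i \<in> V"
    and F: "F face_of generated_zonotope t z n" "F \<noteq> {}"
  shows "\<exists>x\<in>V. F = support_face t z n x"
proof -
  let ?P = "generated_zonotope t z n"
  have "F exposed_face_of ?P"
    using F(1) by (rule exposed_face_of_polyhedron[OF polytope_imp_polyhedron[OF
          polytope_generated_zonotope], THEN iffD2])
  then obtain a b where ab: "?P \<subseteq> {p. a \<bullet> p \<le> b}" "F = ?P \<inter> {p. a \<bullet> p = b}"
    unfolding exposed_face_of_def by blast
  obtain x y where x: "x \<in> span V" "\<And>w. w \<in> span V \<Longrightarrow> orthogonal y w" "a = x + y"
    using orthogonal_subspace_decomp_exists[of V a] by metis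
  have xV: "x \<in> V" using x V by (simp add: span_eq_iff[THEN iffD2])
  have ax: "a \<bullet> p = x \<bullet> p" if "p \<in> ?P" for p
  proof -
    have "p \<in> V" using generated_zonotope_subset[OF assms(1-3)] that by blast
    then have "y \<bullet> p = 0" using x(2) span_base by (auto simp: orthogonal_def)
    then show ?thesis using x by (simp add: inner_add_left)
  qed
  \<comment> \<open>The explicit maximizer bounds the support value by \<open>b\<close>; any point
    of \<open>F\<close> gives the reverse inequality.\<close>
  have "t + sign_sum z n x \<in> ?P" "x \<bullet> (t + sign_sum z n x) = support t z n x"
    using sign_sum_in_support_face by (auto simp: support_face_def)
  then have "support t z n x \<le> b" using ab(1) ax by auto
  moreover obtain q where "q \<in> F" using F by blast
  then have "b \<le> support t z n x" using ab(2) ax inner_le_support by fastforce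
  ultimately have "b = support t z n x" by simp
  then have "F = support_face t z n x" using ab ax by (auto simp: support_face_def)
  then show ?thesis using xV by blast
qed

lemma SUP_inner_generated_zonotope:
  "(SUP p\<in>generated_zonotope t z n. x \<bullet> p) = support t z n x"
proof (rule cSup_eq_maximum)
  show "support t z n x \<in> (\<bullet>) x ` generated_zonotope t z n"
    using sign_sum_in_support_face[of t z n x] by (force simp: support_face_def)
qed (use inner_le_support in blast)

section \<open>Normal cones of a zonotope\<close>

lemma sgn_mult_eq_abs_if_mult_nonneg:
  fixes p q :: real
  assumes "0 \<le> p * q" "p \<noteq> 0"
  shows "sgn p * q = \<bar>q\<bar>"
  using assms by (cases "p > 0") (auto simp: zero_le_mult_iff)

text \<open>On the face of \<open>x\<close>, the coefficient of \<open>z i\<close> is forced to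
  \<open>sgn (x \<bullet> z i)\<close> if this is nonzero and is free otherwise; \<open>c\<close> is
  maximal on the whole face iff it agrees with the forced signs and vanishes on the free
  generators.\<close>

lemma normal_cone_support_face:
  "normal_cone V (generated_zonotope t z n) (support_face t z n x) = sign_cone V z n x"
proof -
  have "(\<forall>p\<in>support_face t z n x. c \<bullet> p = support t z n c) \<longleftrightarrow>
      (\<forall>i<n. 0 \<le> (x \<bullet> z i) * (c \<bullet> z i) \<and> (x \<bullet> z i = 0 \<longrightarrow> c \<bullet> z i = 0))" (is "?A \<longleftrightarrow> ?B") for c
  proof
    assume A: ?A
    have *: "l i * (c \<bullet> z i) = \<bar>c \<bullet> z i\<bar>"
      if "\<forall>i<n. \<bar>l i\<bar> \<le> 1 \<and> l i * (x \<bullet> z i) = \<bar>x \<bullet> z i\<bar>" "i < n" for l i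
    proof -
      have "c \<bullet> (t + (\<Sum>i<n. l i *\<^sub>R z i)) = support t z n c"
        using A that mem_support_face by blast
      then show ?thesis using that inner_eq_support_iff by blast
    qed
    show ?B
    proof (intro allI impI)
      fix i assume i: "i < n"
      \<comment> \<open>The two choices of coefficients differ exactly where
        \<open>x \<bullet> z i = 0\<close>; there both signs give
        \<open>\<bar>c \<bullet> z i\<bar>\<close>, so \<open>c \<bullet> z i = 0\<close>.\<close>
      have 1: "(if x \<bullet> z i \<ge> 0 then 1 else -1) * (c \<bullet> z i) = \<bar>c \<bullet> z i\<bar>"
        using *[of "\<lambda>i. if x \<bullet> z i \<ge> 0 then 1 else -1" i] i by auto
      have 2: "(if x \<bullet> z i > 0 then 1 else -1) * (c \<bullet> z i) = \<bar>c \<bullet> z i\<bar>"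
        using *[of "\<lambda>i. if x \<bullet> z i > 0 then 1 else -1" i] i by auto
      show "0 \<le> (x \<bullet> z i) * (c \<bullet> z i) \<and> (x \<bullet> z i = 0 \<longrightarrow> c \<bullet> z i = 0)"
        using 1 2 by (auto simp: zero_le_mult_iff split: if_splits)
    qed
  next
    assume B: ?B
    show ?A
    proof
      fix p assume "p \<in> support_face t z n x"
      then obtain l where l: "\<forall>i<n. \<bar>l i\<bar> \<le> 1 \<and> l i * (x \<bullet> z i) = \<bar>x \<bullet> z i\<bar>"
        "p = t + (\<Sum>i<n. l i *\<^sub>R z i)"
        using mem_support_face by blast
      have "l i * (c \<bullet> z i) = \<bar>c \<bullet> z i\<bar>" if i: "i < n" for i
      proof (cases "x \<bullet> z i = 0")
        case True
        then show ?thesis using B i by simp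
      next
        case False
        have "l i * (x \<bullet> z i) = sgn (x \<bullet> z i) * (x \<bullet> z i)"
          using l i by (simp add: sgn_mult_self_eq_abs)
        then have "l i = sgn (x \<bullet> z i)" using False by simp
        moreover have "0 \<le> (x \<bullet> z i) * (c \<bullet> z i)" using B i by blast
        ultimately show ?thesis using False sgn_mult_eq_abs_if_mult_nonneg by metis
      qed
      then show "c \<bullet> p = support t z n c" using inner_eq_support_iff l by blast
    qed
  qed
  then show ?thesis
    unfolding normal_cone_def sign_cone_def SUP_inner_generated_zonotope by blast
qed

lemma normal_fan_generated_zonotope:
  assumes "subspace V" "t \<in> V" "\<forall>i<n. z i \<in> V"
  shows "normal_fan V (generated_zonotope t z n) = sign_cone V z n ` V"
proof -
  have "{F. F face_of generated_zonotope t z n \<and> F \<noteq> {}} = support_face t z n ` V"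
  proof (intro equalityI subsetI)
    fix F assume "F \<in> {F. F face_of generated_zonotope t z n \<and> F \<noteq> {}}"
    then show "F \<in> support_face t z n ` V"
      using face_of_generated_zonotope[OF assms, of F] by auto
  next
    fix F assume "F \<in> support_face t z n ` V"
    then obtain x where "F = support_face t z n x" by blast
    then show "F \<in> {F. F face_of generated_zonotope t z n \<and> F \<noteq> {}}"
      using support_face_face_of[of t z n x] sign_sum_in_support_face[of t z n x] by auto
  qed
  moreover have "normal_fan V (generated_zonotope t z n)
      = normal_cone V (generated_zonotope t z n) ` {F. F face_of generated_zonotope t z n \<and> F \<noteq> {}}"
    by (auto simp: normal_fan_def)
  ultimately show ?thesis by (simp only: image_image normal_cone_support_face)
qed

section \<open>Vertices and circumscribed spheres\<close>

lemma support_face_generic: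
  assumes "generic z n x"
  shows "support_face t z n x = {t + sign_sum z n x}"
proof -
  have "p = t + sign_sum z n x" if p: "p \<in> support_face t z n x" for p
  proof -
    obtain l where l: "\<forall>i<n. \<bar>l i\<bar> \<le> 1 \<and> l i * (x \<bullet> z i) = \<bar>x \<bullet> z i\<bar>"
      "p = t + (\<Sum>i<n. l i *\<^sub>R z i)"
      using p[unfolded mem_support_face] by blast
    \<comment> \<open>A zero generator leaves its coefficient free, so only the products with
      \<open>z i\<close> are compared.\<close>
    have "l i *\<^sub>R z i = sgn (x \<bullet> z i) *\<^sub>R z i" if "i < n" for i
    proof (cases "z i = 0")
      case False
      then have "x \<bullet> z i \<noteq> 0" using assms that by (simp add: generic_def)
      moreover have "l i * (x \<bullet> z i) = sgn (x \<bullet> z i) * (x \<bullet> z i)"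
        using l that by (simp add: sgn_mult_self_eq_abs)
      ultimately show ?thesis by simp
    qed simp
    then have "(\<Sum>i<n. l i *\<^sub>R z i) = sign_sum z n x"
      unfolding sign_sum_def by (intro sum.cong) simp_all
    then show ?thesis using l by simp
  qed
  then show ?thesis using sign_sum_in_support_face[of t z n x] by blast
qed

lemma extreme_point_of_generated_zonotope:
  assumes "subspace V" "t \<in> V" "\<forall>i<n. z i \<in> V"
  shows "v extreme_point_of generated_zonotope t z n
    \<longleftrightarrow> (\<exists>x\<in>V. generic z n x \<and> v = t + sign_sum z n x)"
proof
  assume "\<exists>x\<in>V. generic z n x \<and> v = t + sign_sum z n x"
  then obtain x where "generic z n x" "v = t + sign_sum z n x" by blast
  then show "v extreme_point_of generated_zonotope t z n"
    using support_face_face_of[of t z n x] by (simp add: support_face_generic face_of_singleton)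
next
  assume "v extreme_point_of generated_zonotope t z n"
  then obtain x where x: "x \<in> V" "{v} = support_face t z n x"
    using face_of_generated_zonotope[OF assms, of "{v}"] by (auto simp: face_of_singleton)
  then have v: "v = t + sign_sum z n x" using sign_sum_in_support_face[of t z n x] by (simp flip: x(2))
  have "x \<bullet> z i \<noteq> 0" if i: "i < n" "z i \<noteq> 0" for i
  proof
    assume 0: "x \<bullet> z i = 0"
    \<comment> \<open>Raising the \<open>i\<close>-th coefficient from 0 to 1 stays in the face but
      moves the point by \<open>z i\<close>, although the face is a single point.\<close>
    let ?l = "\<lambda>j. if j = i then 1 else sgn (x \<bullet> z j)"
    have "t + (\<Sum>j<n. ?l j *\<^sub>R z j) \<in> support_face t z n x"
      unfolding mem_support_face
      by (intro exI[of _ ?l]) (simp add: 0 sgn_mult_self_eq_abs abs_sgn_le_1)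
    then have "(\<Sum>j<n. ?l j *\<^sub>R z j) = sign_sum z n x" using v by (simp flip: x(2))
    moreover have "(\<Sum>j<n. ?l j *\<^sub>R z j) = (\<Sum>j<n. sgn (x \<bullet> z j) *\<^sub>R z j + (if j = i then z i else 0))"
      by (intro sum.cong) (auto simp: 0)
    ultimately show False using i by (simp add: sum.distrib sign_sum_def)
  qed
  then show "\<exists>x\<in>V. generic z n x \<and> v = t + sign_sum z n x"
    using x v unfolding generic_def by blast
qed

text \<open>
  The vertices come in antipodal pairs about \<^term>\<open>t\<close>, so a circumscribed sphere with any centre
  yields one with centre \<^term>\<open>t\<close>.
\<close>

lemma inscribed_in_generated_zonotope_iff:
  assumes "subspace V" "t \<in> V" "\<forall>i<n. z i \<in> V"
  shows "inscribed_in V (generated_zonotope t z n)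
    \<longleftrightarrow> (\<exists>R. \<forall>x\<in>V. generic z n x \<longrightarrow> sign_sum z n x \<bullet> sign_sum z n x = R)"
proof
  assume "inscribed_in V (generated_zonotope t z n)"
  then obtain c r where sphere: "{v. v extreme_point_of generated_zonotope t z n} \<subseteq> sphere c r"
    unfolding inscribed_in_def by blast
  have c: "dist c (t + sign_sum z n x) = r" if "x \<in> V" "generic z n x" for x
  proof -
    have "(t + sign_sum z n x) extreme_point_of generated_zonotope t z n"
      using extreme_point_of_generated_zonotope[OF assms] that by blast
    then show ?thesis using sphere by (auto simp: subset_iff)
  qed
  have "sign_sum z n x \<bullet> sign_sum z n x = r\<^sup>2 - (c - t) \<bullet> (c - t)" if x: "x \<in> V" "generic z n x" for x
  proof -
    let ?d = "c - t" and ?s = "sign_sum z n x"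
    have "- x \<in> V" using x assms(1) subspace_neg by blast
    then have "dist c (t + ?s) = r" "dist c (t - ?s) = r"
      using c[of x] c[of "- x"] x by (auto simp: generic_minus sign_sum_minus)
    then have "norm (?d - ?s) = r" "norm (?d + ?s) = r"
      by (auto simp: dist_norm algebra_simps)
    then have "(?d - ?s) \<bullet> (?d - ?s) = r\<^sup>2" "(?d + ?s) \<bullet> (?d + ?s) = r\<^sup>2"
      by (auto simp flip: power2_norm_eq_inner)
    \<comment> \<open>Parallelogram law: adding the two equations cancels the cross terms.\<close>
    then show ?thesis
      by (simp add: inner_add_left inner_add_right inner_diff_left inner_diff_right inner_commute)
  qed
  then show "\<exists>R. \<forall>x\<in>V. generic z n x \<longrightarrow> sign_sum z n x \<bullet> sign_sum z n x = R" by blast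
next
  assume "\<exists>R. \<forall>x\<in>V. generic z n x \<longrightarrow> sign_sum z n x \<bullet> sign_sum z n x = R"
  then obtain R where "\<forall>x\<in>V. generic z n x \<longrightarrow> sign_sum z n x \<bullet> sign_sum z n x = R" by blast
  then have "{v. v extreme_point_of generated_zonotope t z n} \<subseteq> sphere t (sqrt R)"
    using extreme_point_of_generated_zonotope[OF assms] by (auto simp: dist_norm norm_eq_sqrt_inner)
  then show "inscribed_in V (generated_zonotope t z n)"
    unfolding inscribed_in_def using assms(2) by blast
qed

section \<open>Normals of an arrangement\<close>

lemma arrangement_in_normals_arrangement:
  assumes V: "subspace V" and z: "\<forall>i<n. z i \<in> V"
  shows "arrangement_in V (normals_arrangement V z n)"
proof -
  have hyperplane: "linear_hyperplane_in V {x \<in> V. x \<bullet> a = 0}" if a: "a \<in> V" "a \<noteq> 0" for a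
  proof -
    have "{x \<in> V. x \<bullet> a = 0} = V \<inter> {x. a \<bullet> x = 0}" by (auto simp: inner_commute)
    then have "subspace {x \<in> V. x \<bullet> a = 0}" using V by (simp add: subspace_inter subspace_hyperplane)
    \<comment> \<open>The hyperplane is the orthogonal complement in \<open>V\<close> of the line
      spanned by \<open>a\<close>, which gives its dimension.\<close>
    moreover have "{y \<in> V. \<forall>x\<in>span {a}. orthogonal x y} = {x \<in> V. x \<bullet> a = 0}"
      by (auto simp: span_singleton orthogonal_def inner_commute)
    moreover have "span {a} \<subseteq> V" using a V by (simp add: span_minimal)
    ultimately show ?thesis
      using dim_subspace_orthogonal_to_vectors[of "span {a}" V] V a(2)
      by (simp add: linear_hyperplane_in_def)
  qed
  have "normals_arrangement V z n \<subseteq> (\<lambda>i. {x \<in> V. x \<bullet> z i = 0}) ` {..<n}"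
    by (auto simp: normals_arrangement_def)
  then have "finite (normals_arrangement V z n)" by (rule finite_subset) simp
  then show ?thesis
    using V z hyperplane by (auto simp: arrangement_in_def normals_arrangement_def)
qed

text \<open>The lengths of these normals are arbitrary; they serve only to express the fan of the
  arrangement by sign cones.\<close>

lemma arrangement_in_UNIV_imp_normals:
  fixes \<A> :: "'a::euclidean_space set set"
  assumes "arrangement_in UNIV \<A>"
  obtains z n where "\<A> = normals_arrangement UNIV z n"
proof -
  from assms have "finite \<A>" and hyp: "\<And>H. H \<in> \<A> \<Longrightarrow> linear_hyperplane_in UNIV H"
    by (auto simp: arrangement_in_def)
  from \<open>finite \<A>\<close> obtain n and f :: "nat \<Rightarrow> 'a set" where f: "\<A> = f ` {i. i < n}"
    using finite_imp_nat_seg_image_inj_on by metis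
  have "\<exists>a. i < n \<longrightarrow> a \<noteq> 0 \<and> f i = {x. x \<bullet> a = 0}" for i
  proof (cases "i < n")
    case True
    then have H: "subspace (f i)" "DIM('a) = dim (f i) + 1"
      using hyp[of "f i"] f by (auto simp: linear_hyperplane_in_def)
    then obtain a where "a \<noteq> 0" "span (f i) = {x. a \<bullet> x = 0}"
      using dim_eq_hyperplane[of "f i"] by auto
    moreover have "span (f i) = f i" using H by (simp add: span_eq_iff)
    ultimately show ?thesis by (auto simp: inner_commute)
  qed simp
  then obtain z where "\<And>i. i < n \<Longrightarrow> z i \<noteq> 0 \<and> f i = {x. x \<bullet> z i = 0}" by metis
  then have "\<A> = normals_arrangement UNIV z n"
    unfolding f normals_arrangement_def by (auto simp: image_iff)
  then show thesis by (rule that)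
qed

text \<open>
  If a hyperplane of the first family is missing from the second, a point of it off the second
  family has a sign cone for the second family that extends to both sides of the hyperplane.
\<close>

lemma normals_arrangement_subset_if_sign_cones_subset:
  fixes z z' :: "nat \<Rightarrow> 'a::euclidean_space"
  assumes cones: "range (sign_cone UNIV z' m) \<subseteq> range (sign_cone UNIV z n)"
  shows "normals_arrangement UNIV z n \<subseteq> normals_arrangement UNIV z' m"
proof
  fix H assume "H \<in> normals_arrangement UNIV z n"
  then obtain i where i: "i < n" "z i \<noteq> 0" "H = {x. x \<bullet> z i = 0}"
    by (auto simp: normals_arrangement_def)
  show "H \<in> normals_arrangement UNIV z' m"
  proof (rule ccontr)
    assume notin: "H \<notin> normals_arrangement UNIV z' m"
    have "subspace H" unfolding i by (rule subspace_hyperplane2)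
    \<comment> \<open>A generic point of \<open>H\<close>; by \<open>transversal\<close> it lies on
      no hyperplane of the second family.\<close>
    then obtain x where x: "x \<in> H" "\<forall>j<m. (\<exists>y\<in>H. y \<bullet> z' j \<noteq> 0) \<longrightarrow> x \<bullet> z' j \<noteq> 0"
      using exists_avoiding_hyperplanes by blast
    have transversal: "\<exists>y\<in>H. y \<bullet> z' j \<noteq> 0" if j: "j < m" "z' j \<noteq> 0" for j
    proof (rule ccontr)
      assume "\<not> (\<exists>y\<in>H. y \<bullet> z' j \<noteq> 0)"
      then have orth: "\<And>y. y \<in> H \<Longrightarrow> y \<bullet> z' j = 0" by blast
      \<comment> \<open>Removing the component along \<open>z i\<close> leaves a vector
        \<open>y\<close> of \<open>H\<close>. It is orthogonal to \<open>z' j\<close> and to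
        \<open>z i\<close>, hence to itself, so the two normals are parallel.\<close>
      define k where "k = (z' j \<bullet> z i) / (z i \<bullet> z i)"
      define y where "y = z' j - k *\<^sub>R z i"
      have yi: "y \<bullet> z i = 0" using i(2) by (simp add: y_def k_def inner_diff_left)
      then have "y \<bullet> z' j = 0" using orth i by simp
      then have "y \<bullet> (z' j - k *\<^sub>R z i) = 0" using yi by (simp add: inner_diff_right)
      then have "y = 0" by (simp flip: y_def)
      then have "z' j = k *\<^sub>R z i" by (simp add: y_def)
      then have "H = {x. x \<bullet> z' j = 0}" using i j by auto
      then show False using notin j by (auto simp: normals_arrangement_def)
    qed
    obtain y where y: "sign_cone UNIV z' m x = sign_cone UNIV z n y" using cones by blast
    \<comment> \<open>No nonzero \<open>z' j\<close> vanishes at \<open>x\<close>, so the cone of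
      \<open>x\<close> contains a step in every direction.\<close>
    have nudge: "\<exists>e>0. x + e *\<^sub>R w \<in> sign_cone UNIV z n y" for w
    proof -
      obtain e where e: "e > 0"
        "\<forall>j<m. x \<bullet> z' j \<noteq> 0 \<longrightarrow> sgn ((x + e *\<^sub>R w) \<bullet> z' j) = sgn (x \<bullet> z' j)"
        using perturb_signs by blast
      have "\<forall>j<m. 0 \<le> (x \<bullet> z' j) * ((x + e *\<^sub>R w) \<bullet> z' j) \<and>
          (x \<bullet> z' j = 0 \<longrightarrow> (x + e *\<^sub>R w) \<bullet> z' j = 0)"
      proof (intro allI impI)
        fix j assume j: "j < m"
        show "0 \<le> (x \<bullet> z' j) * ((x + e *\<^sub>R w) \<bullet> z' j) \<and>
            (x \<bullet> z' j = 0 \<longrightarrow> (x + e *\<^sub>R w) \<bullet> z' j = 0)"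
        proof (cases "z' j = 0")
          case False
          then have "x \<bullet> z' j \<noteq> 0" using x transversal j by blast
          then show ?thesis using e j mult_nonneg_if_sgn_eq by blast
        qed simp
      qed
      then have "x + e *\<^sub>R w \<in> sign_cone UNIV z' m x" by (simp add: sign_cone_def)
      then show ?thesis using e(1) unfolding y by blast
    qed
    obtain e where e: "e > 0" "x + e *\<^sub>R z i \<in> sign_cone UNIV z n y" using nudge by blast
    obtain e' where e': "e' > 0" "x + e' *\<^sub>R (- z i) \<in> sign_cone UNIV z n y" using nudge by blast
    have xi: "x \<bullet> z i = 0" using x i by simp
    have pos: "e * (z i \<bullet> z i) > 0" "e' * (z i \<bullet> z i) > 0" using e e' i by simp_all
    \<comment> \<open>The cone of \<open>y\<close> contains points strictly on both sides of
      \<open>H\<close>, but a nonzero \<open>y \<bullet> z i\<close> allows only one side and a zero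
      value only \<open>H\<close>.\<close>
    have "0 \<le> (y \<bullet> z i) * (e * (z i \<bullet> z i))" and ne: "y \<bullet> z i \<noteq> 0"
      using e i pos by (auto simp: sign_cone_def inner_add_left xi)
    moreover have "0 \<le> (y \<bullet> z i) * - (e' * (z i \<bullet> z i))"
      using e' i by (auto simp: sign_cone_def inner_diff_left xi)
    ultimately show False using pos unfolding zero_le_mult_iff by linarith
  qed
qed

lemma normals_arrangement_eq_if_fan_eq:
  fixes z z' :: "nat \<Rightarrow> 'a::euclidean_space"
  assumes "range (sign_cone UNIV z' m) = range (sign_cone UNIV z n)"
  shows "normals_arrangement UNIV z n = normals_arrangement UNIV z' m"
  using assms by (intro subset_antisym normals_arrangement_subset_if_sign_cones_subset) auto

section \<open>Strong inscribability\<close>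

text \<open>The witness is the zonotope centred at the origin; both fans consist of the same sign
  cones.\<close>

lemma strongly_inscribable_normals_arrangement:
  assumes "subspace V" "\<forall>i<n. z i \<in> V"
    and "\<And>x. x \<in> V \<Longrightarrow> generic z n x \<Longrightarrow> sign_sum z n x \<bullet> sign_sum z n x = R"
  shows "strongly_inscribable V (normals_arrangement V z n)"
  unfolding strongly_inscribable_def
proof (intro conjI exI)
  have 0: "0 \<in> V" using assms(1) subspace_0 by blast
  show "arrangement_in V (normals_arrangement V z n)"
    using assms by (intro arrangement_in_normals_arrangement)
  show "generated_zonotope 0 z n \<subseteq> V"
    using assms 0 by (intro generated_zonotope_subset)
  show "zonotope (generated_zonotope 0 z n)"
    unfolding zonotope_def generated_zonotope_def by blast
  show "inscribed_in V (generated_zonotope 0 z n)"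
    using inscribed_in_generated_zonotope_iff[OF assms(1) 0 assms(2)] assms(3) by blast
  show "normal_fan V (generated_zonotope 0 z n) = arrangement_fan V (normals_arrangement V z n)"
    by (simp only: normal_fan_generated_zonotope[OF assms(1) 0 assms(2)]
        arrangement_fan_eq_sign_cones[OF assms(1,2)])
qed

text \<open>Since the fan determines the arrangement, the generators of the inscribed zonotope can
  replace the normals chosen for \<open>\<A>\<close>.\<close>

lemma strongly_inscribable_UNIV_imp_normals:
  fixes \<A> :: "'a::euclidean_space set set"
  assumes "strongly_inscribable UNIV \<A>"
  obtains z n R where "\<A> = normals_arrangement UNIV z n"
    "\<And>x. generic z n x \<Longrightarrow> sign_sum z n x \<bullet> sign_sum z n x = R"
proof -
  from assms obtain P where P: "arrangement_in UNIV \<A>" "zonotope P" "inscribed_in UNIV P"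
    "normal_fan UNIV P = arrangement_fan UNIV \<A>"
    unfolding strongly_inscribable_def by blast
  from P(2) obtain n z t where PZ: "P = generated_zonotope t z n"
    unfolding zonotope_def generated_zonotope_def by blast
  obtain z' m where \<A>: "\<A> = normals_arrangement UNIV z' m"
    using arrangement_in_UNIV_imp_normals[OF P(1)] by blast
  have "range (sign_cone UNIV z n) = range (sign_cone UNIV z' m)"
    using P(4) unfolding PZ \<A>
    by (simp add: normal_fan_generated_zonotope arrangement_fan_eq_sign_cones)
  then have "\<A> = normals_arrangement UNIV z n"
    using normals_arrangement_eq_if_fan_eq \<A> by metis
  moreover obtain R where "\<And>x. generic z n x \<Longrightarrow> sign_sum z n x \<bullet> sign_sum z n x = R"
    using P(3) unfolding PZ by (subst (asm) inscribed_in_generated_zonotope_iff) auto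
  ultimately show thesis by (rule that)
qed

theorem theorem1p2:
  fixes \<A> :: "(real ^ 'n) set set" and L :: "(real ^ 'n) set"
  assumes "strongly_inscribable UNIV \<A>"
    and "flat_of UNIV \<A> L"
  shows "strongly_inscribable L (restriction \<A> L) \<and>
         strongly_inscribable UNIV (localization \<A> L)"
proof -
  obtain z n R where \<A>: "\<A> = normals_arrangement UNIV z n"
    and R: "\<And>x. generic z n x \<Longrightarrow> sign_sum z n x \<bullet> sign_sum z n x = R"
    using strongly_inscribable_UNIV_imp_normals[OF assms(1)] by blast
  from assms(2) obtain \<B> where \<B>: "\<B> \<subseteq> \<A>" "L = \<Inter>\<B>"
    unfolding flat_of_def by auto
  have "subspace H" if "H \<in> \<A>" for H
    using that by (auto simp: \<A> normals_arrangement_def subspace_hyperplane2)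
  then have L: "subspace L" unfolding \<B> using \<B>(1) by (intro subspace_Inter) blast
  \<comment> \<open>The localization keeps the generator indices by zeroing the generators not orthogonal
    to \<open>L\<close>.\<close>
  define q where "q i = (if \<forall>x\<in>L. x \<bullet> z i = 0 then z i else 0)" for i
  \<comment> \<open>Every hyperplane in \<open>\<B>\<close> contains \<open>L\<close>, so its normal
    survives in \<open>q\<close>.\<close>
  have mem_L: "x \<in> L" if "\<forall>i<n. x \<bullet> q i = 0" for x
    unfolding \<B>(2)
  proof
    fix H assume H: "H \<in> \<B>"
    then obtain i where i: "i < n" "H = {x. x \<bullet> z i = 0}"
      using \<B>(1) by (auto simp: \<A> normals_arrangement_def)
    have "L \<subseteq> H" using H \<B>(2) by blast
    then have "q i = z i" using i by (auto simp: q_def)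
    then show "x \<in> H" using that i by auto
  qed
  \<comment> \<open>The witness is the orthogonal projection of \<open>z i\<close> to
    \<open>L\<close>.\<close>
  have "\<exists>p. p \<in> L \<and> (\<forall>x\<in>L. x \<bullet> p = x \<bullet> z i)" for i
  proof -
    obtain a b where ab: "a \<in> span L" "\<And>w. w \<in> span L \<Longrightarrow> orthogonal b w" "z i = a + b"
      using orthogonal_subspace_decomp_exists[of L "z i"] by metis
    then show ?thesis
      using L by (intro exI[of _ a])
        (auto simp: span_eq_iff[THEN iffD2] orthogonal_def inner_add_right inner_commute)
  qed
  then obtain p where p: "\<And>i. p i \<in> L" "\<And>i x. x \<in> L \<Longrightarrow> x \<bullet> p i = x \<bullet> z i" by metis
  have p_nonzero: "p i \<noteq> 0 \<longleftrightarrow> (\<exists>x\<in>L. x \<bullet> z i \<noteq> 0)" for i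
    using p by (metis inner_eq_zero_iff inner_zero_right)

  \<comment> \<open>For small \<open>e\<close>, \<open>c\<close> decides the sign on generators not
    orthogonal to \<open>L\<close>; on the others \<open>c\<close> vanishes and \<open>x\<close>
    decides.\<close>
  have sum_split: "sign_sum z n (c + e *\<^sub>R x) = sign_sum z n c + sign_sum q n x"
    and generic_split: "generic z n (c + e *\<^sub>R x)"
    if c: "c \<in> L" "generic p n c" and x: "generic q n x" and e: "e > 0"
      "\<forall>i<n. c \<bullet> z i \<noteq> 0 \<longrightarrow> sgn ((c + e *\<^sub>R x) \<bullet> z i) = sgn (c \<bullet> z i)" for c x e
  proof -
    have c_nonzero: "c \<bullet> z i \<noteq> 0" if "i < n" "\<exists>x\<in>L. x \<bullet> z i \<noteq> 0" for i
      using c p p_nonzero that unfolding generic_def by metis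
    show "sign_sum z n (c + e *\<^sub>R x) = sign_sum z n c + sign_sum q n x"
      unfolding sign_sum_def sum.distrib[symmetric]
    proof (rule sum.cong[OF refl])
      fix i assume "i \<in> {..<n}"
      then have i: "i < n" by simp
      show "sgn ((c + e *\<^sub>R x) \<bullet> z i) *\<^sub>R z i = sgn (c \<bullet> z i) *\<^sub>R z i + sgn (x \<bullet> q i) *\<^sub>R q i"
      proof (cases "\<forall>x\<in>L. x \<bullet> z i = 0")
        case True
        then show ?thesis using c e by (simp add: q_def inner_add_left sgn_mult)
      next
        case False
        then have "q i = 0" "c \<bullet> z i \<noteq> 0" using c_nonzero i by (auto simp: q_def)
        then show ?thesis using e i by simp
      qed
    qed
    show "generic z n (c + e *\<^sub>R x)"
      unfolding generic_def
    proof (intro allI impI)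
      fix i assume i: "i < n" "z i \<noteq> 0"
      show "(c + e *\<^sub>R x) \<bullet> z i \<noteq> 0"
      proof (cases "\<forall>x\<in>L. x \<bullet> z i = 0")
        case True
        then have "q i = z i" by (simp add: q_def)
        then have "x \<bullet> z i \<noteq> 0" using x i unfolding generic_def by metis
        then show ?thesis using True c e by (simp add: inner_add_left)
      next
        case False
        then have "c \<bullet> z i \<noteq> 0" using c_nonzero i by blast
        then show ?thesis using e i by (metis sgn_zero_iff)
      qed
    qed
  qed
  have norm_split: "(sign_sum z n c + sign_sum q n x) \<bullet> (sign_sum z n c + sign_sum q n x) = R"
    if "c \<in> L" "generic p n c" "generic q n x" for c x
  proof -
    obtain e where "e > 0" "\<forall>i<n. c \<bullet> z i \<noteq> 0 \<longrightarrow> sgn ((c + e *\<^sub>R x) \<bullet> z i) = sgn (c \<bullet> z i)"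
      using perturb_signs by blast
    then show ?thesis using sum_split generic_split R that by metis
  qed
  \<comment> \<open>Comparing \<open>x\<close> with \<open>-x\<close> in \<open>norm_split\<close>:
    the difference of the two equations gives \<open>orth\<close>, their sum gives
    \<open>pythagoras\<close>.\<close>
  have orth: "sign_sum z n c \<bullet> sign_sum q n x = 0"
    and pythagoras: "sign_sum z n c \<bullet> sign_sum z n c + sign_sum q n x \<bullet> sign_sum q n x = R"
    if "c \<in> L" "generic p n c" "generic q n x" for c x
    using norm_split[OF that] norm_split[of c "- x"] that
    by (simp_all add: generic_minus sign_sum_minus inner_add_left inner_add_right
        inner_diff_left inner_diff_right inner_commute)

  have sum_in_L: "sign_sum z n c \<in> L" if c: "c \<in> L" "generic p n c" for c
  proof (rule mem_L)
    let ?w = "sign_sum z n c"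
    \<comment> \<open>With the signs of \<open>x\<close> adapted to \<open>?w\<close>, the vanishing
      inner product from \<open>orth\<close> becomes a sum of absolute values. Zero terms are
      insensitive to the sign chosen.\<close>
    obtain x where x: "generic q n x" "\<forall>i<n. ?w \<bullet> q i \<noteq> 0 \<longrightarrow> sgn (x \<bullet> q i) = sgn (?w \<bullet> q i)"
      using exists_generic_refinement[of UNIV n q ?w] by auto
    have "(\<Sum>i<n. \<bar>?w \<bullet> q i\<bar>) = (\<Sum>i<n. sgn (x \<bullet> q i) * (?w \<bullet> q i))"
    proof (rule sum.cong[OF refl])
      fix i assume "i \<in> {..<n}"
      then show "\<bar>?w \<bullet> q i\<bar> = sgn (x \<bullet> q i) * (?w \<bullet> q i)"
        using x(2) by (cases "?w \<bullet> q i = 0") (simp_all add: sgn_mult_self_eq_abs)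
    qed
    also have "\<dots> = ?w \<bullet> sign_sum q n x"
      by (simp add: sign_sum_def[of q] inner_sum_right)
    also have "\<dots> = 0" using orth c x(1) by blast
    finally show "\<forall>i<n. ?w \<bullet> q i = 0" by (simp add: sum_nonneg_eq_0_iff)
  qed
  \<comment> \<open>On \<open>L\<close> the signs for \<open>p\<close> and \<open>z\<close> agree,
    so the left side is the projection of the right one to \<open>L\<close>. The right side already
    lies in \<open>L\<close>, hence the difference is orthogonal to itself.\<close>
  have sum_p: "sign_sum p n c = sign_sum z n c" if c: "c \<in> L" "generic p n c" for c
  proof -
    let ?d = "sign_sum p n c - sign_sum z n c"
    have "sign_sum p n c \<in> L" using L p(1) by (intro sign_sum_in_subspace) auto
    then have "?d \<in> L" using L sum_in_L[OF c] by (intro subspace_diff)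
    then have "?d \<bullet> sign_sum p n c = ?d \<bullet> sign_sum z n c"
      using c(1) p(2) by (simp add: sign_sum_def inner_sum_right)
    then have "?d \<bullet> ?d = 0" by (simp add: inner_diff_right)
    then show ?thesis by simp
  qed

  \<comment> \<open>Fixing one generic argument of \<open>pythagoras\<close> makes the norm
    belonging to the other constant.\<close>
  obtain c0 where c0: "c0 \<in> L" "generic p n c0" using exists_generic[OF L] p(1) by blast
  obtain x0 where x0: "generic q n x0" using exists_generic[of UNIV n q] by auto
  have "restriction \<A> L = normals_arrangement L p n"
  proof -
    have inter: "{x. x \<bullet> z i = 0} \<inter> L = {x \<in> L. x \<bullet> p i = 0}" for i using p(2) by auto
    \<comment> \<open>Hyperplanes containing \<open>L\<close> are those whose normal projects to
      zero, which \<open>normals_arrangement\<close> skips.\<close>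
    have proper: "\<not> L \<subseteq> {x. x \<bullet> z i = 0} \<longleftrightarrow> p i \<noteq> 0" for i using p_nonzero by blast
    have "z i \<noteq> 0" if "p i \<noteq> 0" for i using p_nonzero[of i] that by auto
    then have "restriction \<A> L = {{x. x \<bullet> z i = 0} \<inter> L | i. i < n \<and> p i \<noteq> 0}"
      unfolding restriction_def \<A> normals_arrangement_def proper[symmetric] by auto
    then show ?thesis unfolding normals_arrangement_def inter .
  qed
  moreover have "strongly_inscribable L (normals_arrangement L p n)"
  proof (rule strongly_inscribable_normals_arrangement[OF L])
    fix c assume "c \<in> L" "generic p n c"
    then show "sign_sum p n c \<bullet> sign_sum p n c = R - sign_sum q n x0 \<bullet> sign_sum q n x0"
      using pythagoras[of c x0] x0 sum_p by simp
  qed (use p in blast)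
  moreover have "localization \<A> L = normals_arrangement UNIV q n"
  proof -
    \<comment> \<open>A nonzero \<open>q i\<close> equals \<open>z i\<close>, and is kept exactly
      when the hyperplane of \<open>z i\<close> contains \<open>L\<close>.\<close>
    have "(q i \<noteq> 0 \<and> {x. x \<bullet> q i = 0} = H) \<longleftrightarrow> (z i \<noteq> 0 \<and> L \<subseteq> H \<and> {x. x \<bullet> z i = 0} = H)" for i H
      by (auto simp: q_def)
    then show ?thesis
      unfolding localization_def \<A> normals_arrangement_def by blast
  qed
  moreover have "strongly_inscribable UNIV (normals_arrangement UNIV q n)"
  proof (rule strongly_inscribable_normals_arrangement)
    fix x assume "generic q n x"
    then show "sign_sum q n x \<bullet> sign_sum q n x = R - sign_sum z n c0 \<bullet> sign_sum z n c0"
      using pythagoras[OF c0] by (simp add: algebra_simps)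
  qed auto
  ultimately show ?thesis by simp
qed

end
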